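(* None of the following six combinations of a sign pattern (for degree $8$ polynomials) and a pair $(p,n)$ is realizable: (Case 1) $\sigma_1=(+,+,+,-,-,-,-,+,+)$ with $(p,n)=(0,6)$; (Case 2) $\sigma_2=(+,+,-,+,-,-,-,+,+)$ with $(p,n)=(4,0)$; (Case 3) $\sigma_3=(+,+,-,+,-,+,-,-,+)$ with $(p,n)=(4,0)$; (Case 4) $\sigma_4=(+,+,+,-,-,+,-,+,+)$ with $(p,n)=(4,0)$; (Case 5) $\sigma_5=(+,+,+,+,-,+,-,-,+)$ with $(p,n)=(4,0)$; (Case 6) $\sigma_6=(+,+,-,+,-,-,-,-,+)$ with $(p,n)=(4,0)$.
   Context: A real polynomial $P(x)=\sum_{j=0}^{8}a_jx^j$ of degree $8$ defines the sign pattern $(\operatorname{sign} a_8,\operatorname{sign} a_7,\ldots,\operatorname{sign} a_0)$ (signs listed from the leading coefficient down to the constant term; a component $+$ or $-$ means that the coefficient is strictly positive, respectively strictly negative). A sign pattern $\bar\sigma$ together with a pair $(p,n)$ of nonnegative integers is called realizable if there exists a real polynomial of degree $8$ which defines the sign pattern $\bar\sigma$ and which has exactly $p$ positive roots and exactly $n$ negative roots, all of these roots being distinct (i.e. $p$ and $n$ are also the numbers of positive and negative roots counted with multiplicity). *)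

theory Defs
  imports "HOL-Computational_Algebra.Polynomial"
begin

datatype sign = Positive | Negative

primrec has_sign :: "sign \<Rightarrow> real \<Rightarrow> bool" where
  "has_sign Positive a \<longleftrightarrow> a > 0"
| "has_sign Negative a \<longleftrightarrow> a < 0"

text \<open>
  Sign patterns list the leading coefficient first, whereas \<^const>\<open>coeffs\<close> lists the
  constant term first.
\<close>

definition defines_sign_pattern :: "real poly \<Rightarrow> sign list \<Rightarrow> bool" where
  "defines_sign_pattern P \<sigma> \<longleftrightarrow> list_all2 has_sign \<sigma> (rev (coeffs P))"

lemma defines_sign_pattern_iff_coeff:
  assumes "P \<noteq> 0"
  shows "defines_sign_pattern P \<sigma> \<longleftrightarrow>
    length \<sigma> = degree P + 1 \<and> (\<forall>j\<le>degree P. has_sign (\<sigma> ! (degree P - j)) (coeff P j))"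
proof -
  have "(\<forall>i<degree P + 1. has_sign (\<sigma> ! i) (coeff P (degree P - i))) \<longleftrightarrow>
        (\<forall>j\<le>degree P. has_sign (\<sigma> ! (degree P - j)) (coeff P j))"
    by (metis Suc_eq_plus1 diff_diff_cancel diff_le_self less_Suc_eq_le)
  then show ?thesis
    using assms
    by (auto simp: defines_sign_pattern_def list_all2_conv_all_nth rev_nth length_coeffs_degree
        coeffs_nth)
qed

text \<open>
  The two cardinalities count distinct roots; together with the simplicity of the nonzero real
  roots they are also the counts with multiplicity. Non-real roots are unrestricted.
\<close>

definition realizable :: "sign list \<Rightarrow> nat \<Rightarrow> nat \<Rightarrow> bool" where
  "realizable \<sigma> p n \<longleftrightarrow>
    (\<exists>P :: real poly. degree P = 8 \<and> defines_sign_pattern P \<sigma> \<and>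
       card {x. x > 0 \<and> poly P x = 0} = p \<and>
       card {x. x < 0 \<and> poly P x = 0} = n \<and>
       (\<forall>x. x \<noteq> 0 \<and> poly P x = 0 \<longrightarrow> order x P = 1))"

definition \<sigma>\<^sub>1 :: "sign list" where
  "\<sigma>\<^sub>1 = [Positive, Positive, Positive, Negative, Negative, Negative, Negative, Positive, Positive]"

definition \<sigma>\<^sub>2 :: "sign list" where
  "\<sigma>\<^sub>2 = [Positive, Positive, Negative, Positive, Negative, Negative, Negative, Positive, Positive]"

definition \<sigma>\<^sub>3 :: "sign list" where
  "\<sigma>\<^sub>3 = [Positive, Positive, Negative, Positive, Negative, Positive, Negative, Negative, Positive]"

definition \<sigma>\<^sub>4 :: "sign list" where
  "\<sigma>\<^sub>4 = [Positive, Positive, Positive, Negative, Negative, Positive, Negative, Positive, Positive]"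

definition \<sigma>\<^sub>5 :: "sign list" where
  "\<sigma>\<^sub>5 = [Positive, Positive, Positive, Positive, Negative, Positive, Negative, Negative, Positive]"

definition \<sigma>\<^sub>6 :: "sign list" where
  "\<sigma>\<^sub>6 = [Positive, Positive, Negative, Positive, Negative, Negative, Negative, Negative, Positive]"

end

theory Submission
  imports Defs
begin

text \<open>
  Write \<open>\<theta>\<close> for the operator \<open>x d/dx\<close>, under which \<open>x ^ j\<close> is an eigenvector with eigenvalue
  \<open>j\<close>. By Rolle's theorem, \<open>\<theta> - r\<close> destroys at most one positive root, for every real \<open>r\<close>. Hence if
  \<open>P\<close> has more positive roots than \<open>Q(z) = (z - r\<^sub>1) \<dots> (z - r\<^sub>k)\<close> has factors, then
  \<open>\<Sum>j. Q(j) a\<^sub>j y ^ j = 0\<close> for some \<open>y > 0\<close>. If moreover \<open>P\<close> is positive on the negative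
  half-line, subtracting \<open>m P(- t y) > 0\<close> gives \<open>\<Sum>j. (Q(j) - m (- t) ^ j) a\<^sub>j y ^ j < 0\<close>.
  For each of the six patterns there are \<open>r\<^sub>i\<close>, \<open>m\<close> and \<open>t\<close> such that no term of this sum can be
  negative (for the first pattern, after replacing \<open>x\<close> by \<open>- x\<close>). They were found by linear
  programming: a valid \<open>Q\<close>, \<open>m\<close>, \<open>t\<close> is a Farkas certificate.
\<close>

section \<open>Positive roots under the shifted Euler operator\<close>

definition euler_shift :: "real \<Rightarrow> real poly \<Rightarrow> real poly" where
  "euler_shift r P = pCons 0 (pderiv P) - smult r P"

lemma coeff_euler_shift: "coeff (euler_shift r P) j = (real j - r) * coeff P j"
  by (cases j) (simp_all add: euler_shift_def coeff_pderiv algebra_simps)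

lemma poly_euler_shift: "poly (euler_shift r P) x = x * poly (pderiv P) x - r * poly P x"
  by (simp add: euler_shift_def)

text \<open>The increasing enumeration supplies the consecutive roots that Rolle's theorem needs. As
  a lower bound it also covers the zero polynomial, whose infinite root set would have
  \<open>card\<close> 0.\<close>

definition has_positive_roots :: "nat \<Rightarrow> real poly \<Rightarrow> bool" where
  "has_positive_roots n P \<longleftrightarrow>
    (\<exists>x. (\<forall>i<n. x i > 0 \<and> poly P (x i) = 0) \<and> (\<forall>i. Suc i < n \<longrightarrow> x i < x (Suc i)))"

lemma has_positive_roots_card:
  assumes "P \<noteq> 0" and "n \<le> card {x. x > 0 \<and> poly P x = 0}"
  shows "has_positive_roots n P"
proof -
  let ?S = "{x. x > 0 \<and> poly P x = 0}"
  let ?xs = "sorted_list_of_set ?S"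
  have fin: "finite ?S"
    using poly_roots_finite[OF assms(1)] by (rule rev_finite_subset) auto
  have "?xs ! i > 0 \<and> poly P (?xs ! i) = 0" if "i < n" for i
    using that assms(2) fin nth_mem[of i ?xs] by auto
  moreover have "?xs ! i < ?xs ! Suc i" if "Suc i < n" for i
    using that assms(2) sorted_wrt_nth_less[OF strict_sorted_list_of_set[of ?S], of i "Suc i"]
    by simp
  ultimately show ?thesis
    unfolding has_positive_roots_def by blast
qed

text \<open>Up to the factor \<open>x powr (r + 1)\<close>, \<open>euler_shift r P\<close> is the derivative of
  \<open>x powr -r * P x\<close>, so Rolle's theorem applies.\<close>

lemma has_positive_roots_euler_shift:
  assumes "has_positive_roots (Suc n) P"
  shows "has_positive_roots n (euler_shift r P)"
proof -
  obtain x where x: "\<And>i. i \<le> n \<Longrightarrow> x i > 0 \<and> poly P (x i) = 0"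
      "\<And>i. i < n \<Longrightarrow> x i < x (Suc i)"
    using assms unfolding has_positive_roots_def by (metis Suc_less_eq less_Suc_eq_le)
  have deriv: "((\<lambda>z. z powr - r * poly P z) has_real_derivative
      z powr (- r - 1) * poly (euler_shift r P) z) (at z)" if "z > 0" for z
  proof -
    have "z powr - r = z powr (- r - 1) * z"
      using that powr_add[of z "- r - 1" 1] by simp
    then show ?thesis
      using that
      by (auto intro!: derivative_eq_intros poly_DERIV
          simp: poly_euler_shift algebra_simps)
  qed
  have "\<exists>y. x i < y \<and> y < x (Suc i) \<and> poly (euler_shift r P) y = 0" if "i < n" for i
  proof -
    have pos: "x i > 0" using x that by simp
    have "\<exists>y. x i < y \<and> y < x (Suc i) \<and>
        (\<lambda>v. v * (y powr (- r - 1) * poly (euler_shift r P) y)) = (\<lambda>v. 0)"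
    proof (rule Rolle_deriv[where f = "\<lambda>z. z powr - r * poly P z"])
      show "continuous_on {x i..x (Suc i)} (\<lambda>z. z powr - r * poly P z)"
        using pos by (auto intro!: continuous_intros)
    next
      fix z assume "x i < z"
      moreover have "(\<lambda>v. v * c) = (*) c" for c :: real by (simp add: fun_eq_iff mult.commute)
      ultimately show "((\<lambda>z. z powr - r * poly P z) has_derivative
          (\<lambda>v. v * (z powr (- r - 1) * poly (euler_shift r P) z))) (at z)"
        using deriv[of z] pos by (simp add: has_field_derivative_def)
    qed (use x[of i] x[of "Suc i"] x(2)[of i] that in auto)
    then obtain y where y: "x i < y" "y < x (Suc i)"
        "(\<lambda>v. v * (y powr (- r - 1) * poly (euler_shift r P) y)) = (\<lambda>v. 0)"
      by blast
    \<comment> \<open>The derivative vanishes as a linear map; its value at 1 is the number wanted,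
      times a positive power of \<open>y\<close>.\<close>
    have "poly (euler_shift r P) y = 0"
      using fun_cong[OF y(3), of 1] y(1) pos by simp
    with y show ?thesis by blast
  qed
  then obtain y where y: "\<And>i. i < n \<Longrightarrow>
      x i < y i \<and> y i < x (Suc i) \<and> poly (euler_shift r P) (y i) = 0"
    by metis
  have "y i > 0 \<and> poly (euler_shift r P) (y i) = 0" if "i < n" for i
    using y[OF that] x(1)[of i] that by simp
  moreover have "y i < y (Suc i)" if "Suc i < n" for i
    using y[of i] y[of "Suc i"] that by simp
  ultimately show ?thesis
    unfolding has_positive_roots_def by blast
qed

lemma has_positive_roots_fold_euler_shift:
  "has_positive_roots (length rs + n) P \<Longrightarrow> has_positive_roots n (fold euler_shift rs P)"
  by (induction rs arbitrary: P) (simp_all add: has_positive_roots_euler_shift)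

lemma coeff_fold_euler_shift:
  "coeff (fold euler_shift rs P) j = (\<Prod>r\<leftarrow>rs. real j - r) * coeff P j"
  by (induction rs arbitrary: P) (simp_all add: coeff_euler_shift)

section \<open>The certificate inequality\<close>

lemma poly_pos_of_no_root_neg:
  fixes P :: "real poly"
  assumes "coeff P 0 > 0" and "\<And>x. x < 0 \<Longrightarrow> poly P x \<noteq> 0" and "x < 0"
  shows "poly P x > 0"
proof (rule ccontr)
  assume "\<not> poly P x > 0"
  then have "poly P x < 0" using assms(2)[OF \<open>x < 0\<close>] by simp
  moreover have "poly P 0 > 0" using assms(1) by (simp add: poly_0_coeff_0)
  ultimately show False
    using poly_IVT_pos[OF \<open>x < 0\<close>, of P] assms(2) by blast
qed

text \<open>The strict bound on \<open>length rs\<close> leaves a root \<open>y\<close> after all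
  shifts. There the combination equals \<open>- m * poly P (- t * y) < 0\<close>, so its terms
  cannot all be nonnegative.\<close>

lemma exists_coeff_of_wrong_sign:
  assumes roots: "length rs < card {x. x > 0 \<and> poly P x = 0}"
    and c0: "coeff P 0 > 0" and neg: "\<And>x. x < 0 \<Longrightarrow> poly P x \<noteq> 0"
    and "m > 0" "t > 0"
  shows "\<exists>j\<le>degree P. ((\<Prod>r\<leftarrow>rs. real j - r) - m * (- t) ^ j) * coeff P j < 0"
proof (rule ccontr)
  assume "\<not> ?thesis"
  then have nonneg: "((\<Prod>r\<leftarrow>rs. real j - r) - m * (- t) ^ j) * coeff P j \<ge> 0"
    if "j \<le> degree P" for j
    using that by force
  let ?Q = "fold euler_shift rs P"
  have "has_positive_roots (length rs + 1) P"
    using roots c0 by (intro has_positive_roots_card) auto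
  then have "has_positive_roots 1 ?Q"
    by (rule has_positive_roots_fold_euler_shift)
  then obtain y where y: "y > 0" "poly ?Q y = 0"
    unfolding has_positive_roots_def by auto
  \<comment> \<open>Only a bound: a shift equal to \<open>degree P\<close> kills the leading term.
    It suffices for summing both polynomials over one range.\<close>
  have "degree ?Q \<le> degree P"
    by (intro degree_le) (simp add: coeff_fold_euler_shift coeff_eq_0)
  then have "poly ?Q y = (\<Sum>j\<le>degree P. coeff ?Q j * y ^ j)"
    using arg_cong[OF poly_as_sum_of_monoms', of ?Q "degree P" "\<lambda>R. poly R y"]
    by (simp add: poly_sum poly_monom)
  then have "(\<Sum>j\<le>degree P. ((\<Prod>r\<leftarrow>rs. real j - r) - m * (- t) ^ j) * coeff P j * y ^ j) =
      poly ?Q y - m * poly P (- t * y)"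
    by (simp add: poly_altdef[of P] coeff_fold_euler_shift sum_subtractf[symmetric]
        sum_distrib_left power_mult_distrib algebra_simps power_minus[of "t * y"] power_minus[of t])
  also have "\<dots> < 0"
    using poly_pos_of_no_root_neg[OF c0 neg, of "- t * y"] y \<open>m > 0\<close> \<open>t > 0\<close> by simp
  finally show False
    using sum_nonneg[of "{..degree P}"
        "\<lambda>j. ((\<Prod>r\<leftarrow>rs. real j - r) - m * (- t) ^ j) * coeff P j * y ^ j"] nonneg y(1)
    by (simp add: not_less)
qed

section \<open>From realizability to nine sign checks\<close>

lemma card_eq_0_no_root:
  fixes P :: "real poly"
  assumes "P \<noteq> 0" and "card {x. A x \<and> poly P x = 0} = 0" and "A x"
  shows "poly P x \<noteq> 0"
proof -
  \<comment> \<open>Infinite sets also have \<open>card\<close> 0, so finiteness must come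
    first.\<close>
  have "finite {x. A x \<and> poly P x = 0}"
    using poly_roots_finite[OF assms(1)] by (rule rev_finite_subset) auto
  then show ?thesis using assms(2,3) by auto
qed

lemma realizable_coeff_sign:
  assumes "realizable \<sigma> p n"
  obtains P :: "real poly" where "degree P = 8"
    "\<forall>j\<le>8. has_sign (\<sigma> ! (8 - j)) (coeff P j)"
    "card {x. x > 0 \<and> poly P x = 0} = p"
    "card {x. x < 0 \<and> poly P x = 0} = n"
proof -
  obtain P where P: "degree P = 8" "defines_sign_pattern P \<sigma>"
      "card {x. x > 0 \<and> poly P x = 0} = p" "card {x. x < 0 \<and> poly P x = 0} = n"
    using assms unfolding realizable_def by blast
  moreover have "P \<noteq> 0" using P(1) by auto
  ultimately show thesis
    using that[of P] by (simp add: defines_sign_pattern_iff_coeff)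
qed

text \<open>The premise \<open>signs\<close> mentions no polynomial, only the sign of a number
  \<open>a\<close>. Writing its range as \<open>{..8}\<close> lets an explicit enumeration split it
  into nine numerical checks.\<close>

lemma not_realizable_no_negative_root:
  assumes "\<sigma> ! 8 = Positive" and "length rs < p" and "m > 0" "t > 0"
    and signs: "\<And>j a. j \<in> {..8} \<Longrightarrow> has_sign (\<sigma> ! (8 - j)) a \<Longrightarrow>
      ((\<Prod>r\<leftarrow>rs. real j - r) - m * (- t) ^ j) * a \<ge> 0"
  shows "\<not> realizable \<sigma> p 0"
proof
  assume "realizable \<sigma> p 0"
  then obtain P where P: "degree P = 8"
      "\<forall>j\<le>8. has_sign (\<sigma> ! (8 - j)) (coeff P j)"
      "card {x. x > 0 \<and> poly P x = 0} = p" "card {x. x < 0 \<and> poly P x = 0} = 0"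
    by (rule realizable_coeff_sign)
  have "coeff P 0 > 0" using spec[OF P(2), of 0] assms(1) by simp
  moreover have "P \<noteq> 0" using P(1) by auto
  ultimately obtain j where "j \<le> 8"
      "((\<Prod>r\<leftarrow>rs. real j - r) - m * (- t) ^ j) * coeff P j < 0"
    using exists_coeff_of_wrong_sign[of rs P m t] card_eq_0_no_root[OF _ P(4)] P(1,3) assms(2-4)
    by auto
  with signs[of j "coeff P j"] P(2) show False by simp
qed

text \<open>The reflection \<open>x\<close> to \<open>- x\<close> swaps positive and negative roots
  and multiplies the coefficient of index \<open>j\<close> by \<open>(- 1) ^ j\<close>.\<close>

lemma not_realizable_no_positive_root:
  assumes "\<sigma> ! 8 = Positive" and "length rs < n" and "m > 0" "t > 0"
    and signs: "\<And>j a. j \<in> {..8} \<Longrightarrow> has_sign (\<sigma> ! (8 - j)) a \<Longrightarrow>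
      ((\<Prod>r\<leftarrow>rs. real j - r) - m * (- t) ^ j) * ((- 1) ^ j * a) \<ge> 0"
  shows "\<not> realizable \<sigma> 0 n"
proof
  assume "realizable \<sigma> 0 n"
  then obtain P where P: "degree P = 8"
      "\<forall>j\<le>8. has_sign (\<sigma> ! (8 - j)) (coeff P j)"
      "card {x. x > 0 \<and> poly P x = 0} = 0" "card {x. x < 0 \<and> poly P x = 0} = n"
    by (rule realizable_coeff_sign)
  define R where "R = pcompose P [:0, - 1:]"
  have polyR: "poly R x = poly P (- x)" for x
    by (simp add: R_def poly_pcompose)
  have coeffR: "coeff R j = (- 1) ^ j * coeff P j" for j
    by (simp add: R_def coeff_pcompose_linear)
  have "uminus ` {x. x < 0 \<and> poly P x = 0} = {x. x > 0 \<and> poly R x = 0}"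
    by (force simp: polyR image_iff intro: exI[of _ "- x" for x])
  then have "card {x. x > 0 \<and> poly R x = 0} = n"
    using P(4) card_image[of uminus "{x. x < 0 \<and> poly P x = 0}"] by simp
  moreover have "coeff R 0 > 0" using spec[OF P(2), of 0] assms(1) coeffR[of 0] by simp
  moreover have "degree R = 8" by (simp add: R_def P(1) degree_pcompose)
  moreover have "P \<noteq> 0" using P(1) by auto
  ultimately obtain j where "j \<le> 8"
      "((\<Prod>r\<leftarrow>rs. real j - r) - m * (- t) ^ j) * coeff R j < 0"
    using exists_coeff_of_wrong_sign[of rs R m t] card_eq_0_no_root[OF _ P(3)] assms(2-4)
    by (auto simp: polyR)
  with signs[of j "coeff P j"] P(2) coeffR[of j] show False by simp
qed

theorem theorem4:
  shows "\<not> realizable \<sigma>\<^sub>1 0 6 \<and>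
         \<not> realizable \<sigma>\<^sub>2 4 0 \<and>
         \<not> realizable \<sigma>\<^sub>3 4 0 \<and>
         \<not> realizable \<sigma>\<^sub>4 4 0 \<and>
         \<not> realizable \<sigma>\<^sub>5 4 0 \<and>
         \<not> realizable \<sigma>\<^sub>6 4 0"
proof (intro conjI)
  have upto: "{..8::nat} = {0, 1, 2, 3, 4, 5, 6, 7, 8}" by auto
  \<comment> \<open>The product over \<open>rs\<close> has the wrong sign only at
    \<open>j = 3\<close> and \<open>j = 4\<close>; there the alternating term
    \<open>- m * (- t) ^ j\<close> outweighs it.\<close>
  show "\<not> realizable \<sigma>\<^sub>1 0 6"
    by (rule not_realizable_no_positive_root[where rs = "[1/2, 7/2, 13/2, 31/4]"
          and m = 60 and t = "3/4"], unfold upto)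
      (auto simp: \<sigma>\<^sub>1_def zero_le_mult_iff mult_le_0_iff power_divide)
  \<comment> \<open>At \<open>j = 5\<close> the product is -4 and cancels exactly against the term
    4, so that weight is 0; at the roots 1 and 6 only the alternating term remains.\<close>
  show "\<not> realizable \<sigma>\<^sub>2 4 0"
    by (rule not_realizable_no_negative_root[where rs = "[1, 6]" and m = 4 and t = 1], unfold upto)
      (auto simp: \<sigma>\<^sub>2_def zero_le_mult_iff power_divide)
  show "\<not> realizable \<sigma>\<^sub>3 4 0"
    by (rule not_realizable_no_negative_root[where rs = "[1/2, 4]" and m = 1 and t = "3/2"],
        unfold upto)
      (auto simp: \<sigma>\<^sub>3_def zero_le_mult_iff power_divide)
  show "\<not> realizable \<sigma>\<^sub>4 4 0"
    by (rule not_realizable_no_negative_root[where rs = "[2, 11/2]" and m = 9 and t = "2/3"],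
        unfold upto)
      (auto simp: \<sigma>\<^sub>4_def zero_le_mult_iff power_divide)
  show "\<not> realizable \<sigma>\<^sub>5 4 0"
    by (rule not_realizable_no_negative_root[where rs = "[1/4, 7/2]" and m = "1/2" and t = "3/2"],
        unfold upto)
      (auto simp: \<sigma>\<^sub>5_def zero_le_mult_iff power_divide)
  show "\<not> realizable \<sigma>\<^sub>6 4 0"
    by (rule not_realizable_no_negative_root[where rs = "[1/4, 5]" and m = "3/4" and t = "3/2"],
        unfold upto)
      (auto simp: \<sigma>\<^sub>6_def zero_le_mult_iff power_divide)
qed

end
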